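(* Let $S=k_{\mathbf p}[x_1,\dots,x_n]$ be a noncommutative PI skew polynomial ring over a field $k$ of characteristic $0$ (full setting in the context). (1) Up to nonzero scalars, $\mathfrak{oj}_S$, $\mathfrak{oa}_S$ and $\mathfrak{od}_S$ are algebra invariants of $S$; namely, they are independent of the chosen generating set $\{x_1,\dots,x_n\}$: if $\{x_1',\dots,x_n'\}$ is another generating set presenting the algebra $S$ as a skew polynomial ring $k_{\mathbf p'}[x_1',\dots,x_n']$, then the elements $\mathfrak{oj}_S$, $\mathfrak{oa}_S$, $\mathfrak{od}_S$ computed from $\{x_i'\}$ agree with those computed from $\{x_i\}$ up to elements of $k^\times$. (2) The set $\{\mathfrak f_1,\dots,\mathfrak f_n\}$ with multiplicities is an algebra invariant of $S$, i.e. it likewise does not depend on the chosen generating set.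
   Context: Setting: $k$ is a field with $\operatorname{char}k=0$. $\mathbf p=(p_{ij})\in M_n(k)$ is multiplicatively antisymmetric ($p_{ii}=1$, $p_{ji}=p_{ij}^{-1}$) with all $p_{ij}$ roots of unity. $S=k_{\mathbf p}[x_1,\dots,x_n]$ is the $k$-algebra generated by $x_1,\dots,x_n$ with relations $x_jx_i=p_{ij}x_ix_j$, assumed noncommutative; $Z$ is its center. $\mathfrak f_i=\gcd\{d_i\mid \exists\, d_1,\dots,\widehat{d_i},\dots,d_n\text{ with }x_1^{d_1}\cdots x_i^{d_i}\cdots x_n^{d_n}\in Z\}$ (exponents nonnegative integers). The ozone Jacobian is $\mathfrak{oj}_S=\prod_{i=1}^n x_i^{\mathfrak f_i-1}$, the ozone arrangement is $\mathfrak{oa}_S=\prod_{\mathfrak f_i>1}x_i$, and the ozone discriminant is $\mathfrak{od}_S=\prod_{\mathfrak f_i>1}x_i^{\mathfrak f_i}$. *)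

theory Defs
  imports Complex_Main "HOL-Library.Poly_Mapping" "HOL-Library.Multiset"
begin

text \<open>
  Words over the alphabet \<open>'n\<close> form the free monoid, written additively so that
  \<open>'n list \<Rightarrow>\<^sub>0 'k\<close>, with the convolution product of \<^theory>\<open>HOL-Library.Poly_Mapping\<close>,
  is the free associative \<open>'k\<close>-algebra on generators indexed by \<open>'n\<close>.
\<close>

instantiation list :: (type) monoid_add
begin

definition zero_list :: "'a list" where "zero_list = []"

definition plus_list :: "'a list \<Rightarrow> 'a list \<Rightarrow> 'a list" where "plus_list = append"

instance
  by standard (simp_all add: zero_list_def plus_list_def)

end

locale assoc_algebra = vector_space scale
  for scale :: "'k::field \<Rightarrow> 's::ring_1 \<Rightarrow> 's" +
  assumes scale_mult_left: "scale c (a * b) = scale c a * b"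
    and scale_mult_right: "scale c (a * b) = a * scale c b"

definition center :: "'s::ring_1 set"
  where "center = {z. \<forall>a. z * a = a * z}"

definition two_sided_ideal :: "'a::ring_1 set \<Rightarrow> bool"
  where "two_sided_ideal I \<longleftrightarrow>
    0 \<in> I \<and> (\<forall>a\<in>I. \<forall>b\<in>I. a + b \<in> I) \<and> (\<forall>a\<in>I. \<forall>r. r * a \<in> I \<and> a * r \<in> I)"

definition ideal_generated :: "'a::ring_1 set \<Rightarrow> 'a set"
  where "ideal_generated G = \<Inter>{I. two_sided_ideal I \<and> G \<subseteq> I}"

definition free_eval ::
    "('k::field \<Rightarrow> 's::ring_1 \<Rightarrow> 's) \<Rightarrow> ('n \<Rightarrow> 's) \<Rightarrow> ('n list \<Rightarrow>\<^sub>0 'k) \<Rightarrow> 's"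
  where "free_eval scale x f =
    (\<Sum>w\<in>Poly_Mapping.keys f. scale (Poly_Mapping.lookup f w) (prod_list (map x w)))"

text \<open>The condition \<open>p i j \<noteq> 0\<close> is not redundant, because \<open>inverse 0 = 0\<close>.\<close>

definition mult_antisymmetric :: "('n \<Rightarrow> 'n \<Rightarrow> 'k::field) \<Rightarrow> bool"
  where "mult_antisymmetric p \<longleftrightarrow>
    (\<forall>i. p i i = 1) \<and> (\<forall>i j. p i j \<noteq> 0 \<and> p j i = inverse (p i j))"

definition skew_relations :: "('n \<Rightarrow> 'n \<Rightarrow> 'k::field) \<Rightarrow> ('n list \<Rightarrow>\<^sub>0 'k) set"
  where "skew_relations p =
    {Poly_Mapping.single [j, i] 1 - Poly_Mapping.single [i, j] (p i j) | i j. True}"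

text \<open>
  The family \<open>x\<close> presents the algebra as \<open>k\<^sub>p[x\<^sub>1, \<dots>, x\<^sub>n]\<close>, where \<open>n\<close> is the number of elements
  of \<open>'n\<close>: the algebra is the quotient of the free algebra by the ideal of the relations
  \<open>x\<^sub>j x\<^sub>i = p\<^sub>i\<^sub>j x\<^sub>i x\<^sub>j\<close>.
\<close>

definition skew_presentation ::
    "('k::field \<Rightarrow> 's::ring_1 \<Rightarrow> 's) \<Rightarrow> ('n::finite \<Rightarrow> 'n \<Rightarrow> 'k) \<Rightarrow> ('n \<Rightarrow> 's) \<Rightarrow> bool"
  where "skew_presentation scale p x \<longleftrightarrow>
    mult_antisymmetric p \<and>
    surj (free_eval scale x) \<and>
    {f. free_eval scale x f = 0} = ideal_generated (skew_relations p)"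

text \<open>The order on \<open>'n\<close> serves only to write the factors of a monomial in increasing order.\<close>

definition monomial :: "('n::{finite,linorder} \<Rightarrow> 's::ring_1) \<Rightarrow> ('n \<Rightarrow> nat) \<Rightarrow> 's"
  where "monomial x d = prod_list (map (\<lambda>i. x i ^ d i) (sorted_list_of_set UNIV))"

definition ozone_exponent :: "('n::{finite,linorder} \<Rightarrow> 's::ring_1) \<Rightarrow> 'n \<Rightarrow> nat"
  where "ozone_exponent x i = Gcd {d i | d. monomial x d \<in> center}"

definition ozone_jacobian :: "('n::{finite,linorder} \<Rightarrow> 's::ring_1) \<Rightarrow> 's"
  where "ozone_jacobian x = monomial x (\<lambda>i. ozone_exponent x i - 1)"

definition ozone_arrangement :: "('n::{finite,linorder} \<Rightarrow> 's::ring_1) \<Rightarrow> 's"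
  where "ozone_arrangement x = monomial x (\<lambda>i. if ozone_exponent x i > 1 then 1 else 0)"

definition ozone_discriminant :: "('n::{finite,linorder} \<Rightarrow> 's::ring_1) \<Rightarrow> 's"
  where "ozone_discriminant x =
    monomial x (\<lambda>i. if ozone_exponent x i > 1 then ozone_exponent x i else 0)"

end

theory Submission
  imports Defs "HOL-Library.Multiset_Order" "HOL-Computational_Algebra.Primes"
begin

text \<open>
  Ordered monomials form a basis of \<open>S\<close> and multiply like multisets up to nonzero scalars.
  Comparing largest and smallest exponents in a total order shows that \<open>S\<close> is a domain, that
  \<open>a\<^sup>L = x\<^sub>i\<^sup>L\<close> forces \<open>a\<close> to be a multiple of \<open>x\<^sub>i\<close>, and that the generators are irreducible.

  Some power \<open>L\<close> makes all \<open>x\<^sub>i\<^sup>L\<close> central, and then all \<open>x'\<^sub>j\<^sup>L\<close> as well: normality gives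
  \<open>x'\<^sub>j x\<^sub>i = b x'\<^sub>j\<close> with \<open>b\<^sup>L = x\<^sub>i\<^sup>L\<close>, so \<open>b = c x\<^sub>i\<close> with \<open>c\<^sup>L = 1\<close>.
  If \<open>f\<^sub>i > 1\<close>, take a prime \<open>q\<close> dividing \<open>f\<^sub>i\<close>, hence \<open>L\<close>; the field contains some \<open>\<zeta> \<noteq> 1\<close> with
  \<open>\<zeta>\<^sup>q = 1\<close>, and the reflection \<open>g\<close> that multiplies \<open>x\<^sub>i\<close> by \<open>\<zeta>\<close> and fixes the other generators fixes
  the center. Hence \<open>g (x'\<^sub>j)\<^sup>L = x'\<^sub>j\<^sup>L\<close>, so \<open>g\<close> is diagonal in the \<open>x'\<^sub>j\<close> too. It moves some
  \<open>x'\<^sub>j\<close>; since \<open>g a - a \<in> x\<^sub>i S\<close>, that \<open>x'\<^sub>j\<close> is divisible by \<open>x\<^sub>i\<close> and, being irreducible, is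
  proportional to it. Finally \<open>f\<^sub>i\<close> is the gcd of the \<open>x\<^sub>i\<close>-adic valuations of the nonzero central
  elements, so it depends only on \<open>x\<^sub>i\<close> up to a scalar.
\<close>

section \<open>Linear functionals on the free algebra\<close>

lemma poly_mapping_single_add_induct [case_names zero single add]:
  assumes "P 0" and "\<And>k v. P (Poly_Mapping.single k v)" and "\<And>f g. P f \<Longrightarrow> P g \<Longrightarrow> P (f + g)"
  shows "P f"
proof (induction f rule: update_induct)
  case const
  show ?case by fact
next
  case (update f k v)
  have "Poly_Mapping.update k v f = Poly_Mapping.single k v + f"
    using update(1) by (intro poly_mapping_eqI)
      (auto simp: lookup_add lookup_update lookup_single when_def in_keys_iff)
  then show ?case
    using assms update.IH by metis
qed

definition linear_extension :: "('w \<Rightarrow> 'k) \<Rightarrow> ('w \<Rightarrow>\<^sub>0 'k) \<Rightarrow> 'k::field"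
  where "linear_extension h f = (\<Sum>w\<in>Poly_Mapping.keys f. Poly_Mapping.lookup f w * h w)"

lemma linear_extension_add:
  "linear_extension h (f + g) = linear_extension h f + linear_extension h g"
  unfolding linear_extension_def
  by (rule setsum_keys_plus_distrib) (simp_all add: algebra_simps)

lemma linear_extension_zero [simp]: "linear_extension h 0 = 0"
  by (simp add: linear_extension_def)

lemma linear_extension_single [simp]:
  "linear_extension h (Poly_Mapping.single w c) = c * h w"
  by (simp add: linear_extension_def)

lemma linear_extension_diff:
  "linear_extension h (f - g) = linear_extension h f - linear_extension h g"
  by (metis diff_add_cancel eq_diff_eq linear_extension_add)

lemma linear_extension_single_times:
  "linear_extension h (Poly_Mapping.single a c * f) = c * linear_extension (\<lambda>w. h (a + w)) f"
  by (induction f rule: poly_mapping_single_add_induct)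
    (simp_all add: mult_single linear_extension_add algebra_simps)

lemma linear_extension_times_single:
  "linear_extension h (f * Poly_Mapping.single a c) = c * linear_extension (\<lambda>w. h (w + a)) f"
  by (induction f rule: poly_mapping_single_add_induct)
    (simp_all add: mult_single linear_extension_add algebra_simps)

text \<open>The kernel of one functional need not be an ideal. The elements killed by all its
  translates under left and right concatenation do form one, and the hypothesis on \<open>h\<close>
  places the relations in it.\<close>

lemma linear_extension_ideal_generated_skew:
  fixes h :: "'n list \<Rightarrow> 'k::field"
  assumes h: "\<And>u v i j. h (u @ [j, i] @ v) = p i j * h (u @ [i, j] @ v)"
    and f: "f \<in> ideal_generated (skew_relations p)"
  shows "linear_extension h f = 0"
proof -
  define I where "I = {f. \<forall>u v. linear_extension (\<lambda>w. h (u + w + v)) f = 0}"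
  have left: "r * f \<in> I" if "f \<in> I" for r f
    using that
    by (induction r rule: poly_mapping_single_add_induct)
      (simp_all add: I_def linear_extension_single_times linear_extension_add distrib_right
        flip: add.assoc)
  have right: "f * r \<in> I" if "f \<in> I" for r f
    using that
    by (induction r rule: poly_mapping_single_add_induct)
      (simp_all add: I_def linear_extension_times_single linear_extension_add distrib_left
        add.assoc)
  have "0 \<in> I" and "\<forall>a\<in>I. \<forall>b\<in>I. a + b \<in> I"
    by (simp_all add: I_def linear_extension_add)
  then have "two_sided_ideal I"
    unfolding two_sided_ideal_def using left right by blast
  moreover have "skew_relations p \<subseteq> I"
  proof
    fix r assume "r \<in> skew_relations p"
    then obtain i j where r: "r = Poly_Mapping.single [j, i] 1 - Poly_Mapping.single [i, j] (p i j)"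
      unfolding skew_relations_def by blast
    show "r \<in> I"
      unfolding r I_def mem_Collect_eq linear_extension_diff linear_extension_single plus_list_def
      using h[of _ j i] by (simp only: append_assoc mult_1_left diff_self) simp
  qed
  ultimately have "f \<in> I"
    using f unfolding ideal_generated_def by blast
  then have "linear_extension (\<lambda>w. h (0 + w + 0)) f = 0"
    unfolding I_def by blast
  then show ?thesis by simp
qed

text \<open>
  The weights \<open>p b a\<close> of the inversions are the scalars that arise when a word is sorted by means of
  \<open>x\<^sub>a x\<^sub>b = p\<^sub>b\<^sub>a x\<^sub>b x\<^sub>a\<close>. Being compatible with the relations, they yield well-defined coefficients.
\<close>

primrec inversion_weight :: "('n::linorder \<Rightarrow> 'n \<Rightarrow> 'k::field) \<Rightarrow> 'n list \<Rightarrow> 'k"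
  where
    "inversion_weight p [] = 1"
  | "inversion_weight p (a # w) =
      (\<Prod>b\<in>#mset w. if b < a then p b a else 1) * inversion_weight p w"

lemma inversion_weight_nonzero:
  assumes "mult_antisymmetric p"
  shows "inversion_weight p w \<noteq> 0"
proof -
  have "p i j \<noteq> 0" for i j
    using assms unfolding mult_antisymmetric_def by blast
  then show ?thesis
    by (induction w) auto
qed

text \<open>Swapping neighbours affects only the factor of that pair: letters to the left see the
  rest of the word only as a multiset.\<close>

lemma inversion_weight_swap:
  assumes "mult_antisymmetric p"
  shows "inversion_weight p (u @ [j, i] @ v) = p i j * inversion_weight p (u @ [i, j] @ v)"
proof (induction u)
  case Nil
  have "p i i = 1" "p i j * p j i = 1"
    using assms unfolding mult_antisymmetric_def by (metis right_inverse)+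
  then show ?case
    by (cases i j rule: linorder_cases) auto
next
  case (Cons a u)
  then show ?case by (simp add: add_mset_commute)
qed

lemma inversion_weight_sorted: "sorted w \<Longrightarrow> inversion_weight p w = 1"
proof (induction w)
  case (Cons a w)
  then have "(\<Prod>b\<in>#mset w. if b < a then p b a else 1) = prod_mset (image_mset (\<lambda>_. 1) (mset w))"
    by (intro arg_cong[where f = prod_mset] image_mset_cong) auto
  then show ?case using Cons by simp
qed simp

section \<open>The monomial basis\<close>

locale skew_polynomial = assoc_algebra scale
  for scale :: "'k::field \<Rightarrow> 's::ring_1 \<Rightarrow> 's" +
  fixes p :: "'n::{finite,linorder} \<Rightarrow> 'n \<Rightarrow> 'k" and x :: "'n \<Rightarrow> 's"
  assumes presentation: "skew_presentation scale p x"
begin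

lemma antisymmetric: "mult_antisymmetric p"
  using presentation by (simp add: skew_presentation_def)

lemma free_eval_add: "free_eval scale x (f + g) = free_eval scale x f + free_eval scale x g"
  unfolding free_eval_def
  by (rule setsum_keys_plus_distrib) (simp_all add: scale_left_distrib)

lemma free_eval_single: "free_eval scale x (Poly_Mapping.single w c) = scale c (prod_list (map x w))"
  by (simp add: free_eval_def)

lemma free_eval_diff: "free_eval scale x (f - g) = free_eval scale x f - free_eval scale x g"
  by (metis diff_add_cancel eq_diff_eq free_eval_add)

lemma skew_commute: "x j * x i = scale (p i j) (x i * x j)"
proof -
  let ?r = "Poly_Mapping.single [j, i] 1 - Poly_Mapping.single [i, j] (p i j)"
  have "?r \<in> ideal_generated (skew_relations p)"
    unfolding ideal_generated_def skew_relations_def by blast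
  then have "free_eval scale x ?r = 0"
    using presentation by (auto simp: skew_presentation_def)
  then show ?thesis
    by (simp add: free_eval_diff free_eval_single)
qed

text \<open>Exponents are multisets because these carry a total order that addition preserves
  strictly, which makes extreme exponents additive.\<close>

definition mon :: "'n multiset \<Rightarrow> 's"
  where "mon M = prod_list (map x (sorted_list_of_multiset M))"

lemma mon_empty [simp]: "mon {#} = 1"
  by (simp add: mon_def)

lemma mon_single [simp]: "mon {#i#} = x i"
  by (simp add: mon_def)

lemma times_sorted_word:
  assumes "sorted w"
  shows "x a * prod_list (map x w) =
    scale (\<Prod>b\<in>#mset w. if b < a then p b a else 1) (prod_list (map x (insort a w)))"
  using assms
proof (induction w)
  case (Cons b w)
  show ?case
  proof (cases "a \<le> b")
    case True
    then have "(\<Prod>b\<in>#mset (b # w). if b < a then p b a else 1) =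
        prod_mset (image_mset (\<lambda>_. 1) (mset (b # w)))"
      using Cons.prems by (intro arg_cong[where f = prod_mset] image_mset_cong) auto
    then show ?thesis using True by simp
  next
    case False
    have "x a * prod_list (map x (b # w)) = x a * x b * prod_list (map x w)"
      by (simp add: mult.assoc)
    also have "\<dots> = scale (p b a) (x b * (x a * prod_list (map x w)))"
      by (simp add: skew_commute[of a b] mult.assoc flip: scale_mult_left)
    finally show ?thesis
      using False Cons by (simp flip: scale_mult_right)
  qed
qed simp

lemma word_eq_mon: "prod_list (map x w) = scale (inversion_weight p w) (mon (mset w))"
proof (induction w)
  case (Cons a w)
  then have "prod_list (map x (a # w)) =
      scale (inversion_weight p w) (x a * prod_list (map x (sorted_list_of_multiset (mset w))))"
    unfolding mon_def by (simp add: scale_mult_right)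
  then show ?case
    by (subst (asm) times_sorted_word) (simp_all add: mon_def mult.commute del: sorted_list_of_multiset_mset)
qed simp

text \<open>\<open>inv\<close> picks an arbitrary preimage in the free algebra;
  \<open>coef_free_eval\<close> shows that every preimage gives the same value.\<close>

definition coef :: "'s \<Rightarrow> 'n multiset \<Rightarrow> 'k"
  where "coef a M =
    linear_extension (\<lambda>w. if mset w = M then inversion_weight p w else 0) (inv (free_eval scale x) a)"

text \<open>Two preimages differ by an element of the ideal of relations, where the functional
  vanishes because inversion weights obey the relations.\<close>

lemma coef_free_eval:
  "coef (free_eval scale x f) M =
    linear_extension (\<lambda>w. if mset w = M then inversion_weight p w else 0) f"
proof -
  let ?h = "\<lambda>w. if mset w = M then inversion_weight p w else 0"
  let ?g = "inv (free_eval scale x) (free_eval scale x f)"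
  have "free_eval scale x ?g = free_eval scale x f"
    by (simp add: f_inv_into_f)
  then have "?g - f \<in> ideal_generated (skew_relations p)"
    using presentation by (auto simp: skew_presentation_def free_eval_diff)
  moreover have "?h (u @ [j, i] @ v) = p i j * ?h (u @ [i, j] @ v)" for u v i j
    using inversion_weight_swap[OF antisymmetric, of u j i v] by (simp add: add_mset_commute)
  ultimately have "linear_extension ?h (?g - f) = 0"
    by (intro linear_extension_ideal_generated_skew)
  then show ?thesis
    by (simp add: coef_def linear_extension_diff)
qed

lemma free_eval_surj: obtains f where "a = free_eval scale x f"
  using presentation by (auto simp: skew_presentation_def surj_def)

lemma coef_add: "coef (a + b) M = coef a M + coef b M"
  by (rule free_eval_surj[of a], rule free_eval_surj[of b])
    (simp add: coef_free_eval linear_extension_add flip: free_eval_add)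

lemma free_eval_scale:
  "free_eval scale x (Poly_Mapping.single 0 c * f) = scale c (free_eval scale x f)"
  by (induction f rule: poly_mapping_single_add_induct)
    (simp_all add: mult_single free_eval_add free_eval_single scale_right_distrib distrib_left,
      simp add: free_eval_def)

lemma coef_scale: "coef (scale c a) M = c * coef a M"
  by (rule free_eval_surj[of a])
    (simp add: coef_free_eval linear_extension_single_times cong: if_cong flip: free_eval_scale)

lemma coef_zero [simp]: "coef 0 M = 0"
  using coef_scale[of 0 0 M] by simp

lemma coef_diff: "coef (a - b) M = coef a M - coef b M"
  by (metis add_diff_cancel coef_add diff_add_cancel)

lemma coef_sum: "coef (\<Sum>i\<in>A. f i) M = (\<Sum>i\<in>A. coef (f i) M)"
  by (induction A rule: infinite_finite_induct) (simp_all add: coef_add)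

text \<open>Linear independence of the ordered monomials: the sorted word is a preimage of weight
  1.\<close>

lemma coef_mon: "coef (mon M) N = (if M = N then 1 else 0)"
proof -
  have "mon M = free_eval scale x (Poly_Mapping.single (sorted_list_of_multiset M) 1)"
    by (simp add: free_eval_single mon_def)
  then show ?thesis
    by (simp add: coef_free_eval inversion_weight_sorted)
qed

section \<open>Supports and the basis property\<close>

definition supp :: "'s \<Rightarrow> 'n multiset set"
  where "supp a = {M. coef a M \<noteq> 0}"

lemma finite_supp [simp]: "finite (supp a)"
proof (rule free_eval_surj[of a])
  fix f assume a: "a = free_eval scale x f"
  have "supp a \<subseteq> mset ` Poly_Mapping.keys f"
    unfolding supp_def a coef_free_eval linear_extension_def
    by (auto elim!: sum.not_neutral_contains_not_neutral split: if_splits)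
  then show ?thesis by (rule finite_subset) simp
qed

text \<open>Spanning: each word of a preimage is a multiple of a sorted one, and words with the same
  letters are collected into one term.\<close>

lemma mon_expansion: "a = (\<Sum>M\<in>supp a. scale (coef a M) (mon M))"
proof (rule free_eval_surj[of a])
  fix f assume a: "a = free_eval scale x f"
  have sub: "supp a \<subseteq> mset ` Poly_Mapping.keys f"
    unfolding supp_def a coef_free_eval linear_extension_def
    by (auto elim!: sum.not_neutral_contains_not_neutral split: if_splits)
  let ?t = "\<lambda>w. scale (Poly_Mapping.lookup f w * inversion_weight p w) (mon (mset w))"
  have "a = (\<Sum>w\<in>Poly_Mapping.keys f. ?t w)"
    by (simp add: a free_eval_def word_eq_mon)
  also have "\<dots> = (\<Sum>M\<in>mset ` Poly_Mapping.keys f.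
      \<Sum>w\<in>{w \<in> Poly_Mapping.keys f. mset w = M}. ?t w)"
    by (rule sum.group[symmetric]) auto
  also have "\<dots> = (\<Sum>M\<in>mset ` Poly_Mapping.keys f. scale (coef a M) (mon M))"
    by (auto simp: a coef_free_eval linear_extension_def scale_sum_left sum.inter_filter
        intro!: sum.cong)
  also have "\<dots> = (\<Sum>M\<in>supp a. scale (coef a M) (mon M))"
    using sub by (intro sum.mono_neutral_right) (auto simp: supp_def)
  finally show ?thesis .
qed

lemma coef_eqI:
  assumes "\<And>M. coef a M = coef b M"
  shows "a = b"
proof -
  have "supp a = supp b"
    using assms by (simp add: supp_def)
  then show ?thesis
    using mon_expansion[of a] mon_expansion[of b] assms by simp
qed

lemma supp_empty_iff [simp]: "supp a = {} \<longleftrightarrow> a = 0"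
proof
  assume "supp a = {}"
  then show "a = 0" using mon_expansion[of a] by simp
qed (simp add: supp_def)

lemma supp_mon [simp]: "supp (mon M) = {M}"
  by (auto simp: supp_def coef_mon)

lemma supp_x [simp]: "supp (x i) = {{#i#}}"
  using supp_mon[of "{#i#}"] by simp

lemma supp_scale [simp]: "c \<noteq> 0 \<Longrightarrow> supp (scale c a) = supp a"
  by (simp add: supp_def coef_scale)

lemma supp_one [simp]: "supp 1 = {{#}}"
  using supp_mon[of "{#}"] by simp

lemma one_neq_zero: "(1 :: 's) \<noteq> 0"
  by (metis insert_not_empty supp_empty_iff supp_one)

lemma x_nonzero: "x i \<noteq> 0"
  by (metis insert_not_empty supp_empty_iff supp_x)

lemma coef_combination:
  "finite A \<Longrightarrow> coef (\<Sum>M\<in>A. scale (f M) (mon M)) N = (if N \<in> A then f N else 0)"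
  by (simp add: coef_sum coef_scale coef_mon if_distrib[of "\<lambda>t. _ * t"] cong: if_cong)

lemma supp_singletonD:
  assumes "supp a = {M}"
  shows "\<exists>c. c \<noteq> 0 \<and> a = scale c (mon M)"
  using mon_expansion[of a] assms unfolding supp_def by auto

text \<open>The cocycle that presents the algebra as a twisted monoid algebra over
  multisets.\<close>

definition twist :: "'n multiset \<Rightarrow> 'n multiset \<Rightarrow> 'k"
  where "twist M N = inversion_weight p (sorted_list_of_multiset M @ sorted_list_of_multiset N)"

lemma twist_nonzero [simp]: "twist M N \<noteq> 0"
  by (simp add: twist_def inversion_weight_nonzero antisymmetric)

lemma mon_times: "mon M * mon N = scale (twist M N) (mon (M + N))"
proof -
  have "mon M * mon N = prod_list (map x (sorted_list_of_multiset M @ sorted_list_of_multiset N))"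
    by (simp add: mon_def)
  then show ?thesis
    by (simp only: word_eq_mon twist_def mset_append mset_sorted_list_of_multiset)
qed

lemma coef_times:
  "coef (a * b) K =
    (\<Sum>M\<in>supp a. \<Sum>N\<in>supp b. if M + N = K then coef a M * coef b N * twist M N else 0)"
proof -
  have "a * b = (\<Sum>M\<in>supp a. scale (coef a M) (mon M)) * (\<Sum>N\<in>supp b. scale (coef b N) (mon N))"
    using mon_expansion[of a] mon_expansion[of b] by simp
  also have "\<dots> = (\<Sum>M\<in>supp a. \<Sum>N\<in>supp b.
      scale (coef a M * coef b N * twist M N) (mon (M + N)))"
    by (simp add: sum_product mon_times mult.commute mult.left_commute flip: scale_mult_left scale_mult_right)
  finally show ?thesis
    by (auto simp: coef_sum coef_scale coef_mon intro!: sum.cong)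
qed

subsection \<open>Extreme exponents\<close>

lemma supp_times:
  assumes "K \<in> supp (a * b)"
  shows "\<exists>M\<in>supp a. \<exists>N\<in>supp b. K = M + N"
proof (rule ccontr)
  assume "\<not> ?thesis"
  then have "coef (a * b) K = 0"
    unfolding coef_times by (intro sum.neutral ballI) auto
  then show False using assms by (simp add: supp_def)
qed

text \<open>An exponent that splits in only one way over the two supports receives a single
  contribution, so nothing can cancel.\<close>

lemma coef_times_unique:
  assumes "M \<in> supp a" and "N \<in> supp b"
    and "\<And>M' N'. M' \<in> supp a \<Longrightarrow> N' \<in> supp b \<Longrightarrow> M' + N' = M + N \<Longrightarrow> M' = M \<and> N' = N"
  shows "coef (a * b) (M + N) = coef a M * coef b N * twist M N"
proof -
  have "coef (a * b) (M + N) = (\<Sum>M'\<in>supp a. \<Sum>N'\<in>supp b.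
      if M' = M then if N' = N then coef a M * coef b N * twist M N else 0 else 0)"
    unfolding coef_times using assms(3) by (intro sum.cong refl) auto
  also have "\<dots> = (\<Sum>M'\<in>supp a. if M' = M then coef a M * coef b N * twist M N else 0)"
    using assms(2) by (intro sum.cong refl) auto
  finally show ?thesis using assms(1) by simp
qed

lemma supp_times_unique:
  assumes "M \<in> supp a" and "N \<in> supp b"
    and "\<And>M' N'. M' \<in> supp a \<Longrightarrow> N' \<in> supp b \<Longrightarrow> M' + N' = M + N \<Longrightarrow> M' = M \<and> N' = N"
  shows "M + N \<in> supp (a * b)"
proof -
  have "coef (a * b) (M + N) = coef a M * coef b N * twist M N"
    using assms by (rule coef_times_unique)
  moreover have "coef a M \<noteq> 0" "coef b N \<noteq> 0"
    using assms(1,2) by (simp_all add: supp_def)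
  ultimately show ?thesis
    unfolding supp_def by simp
qed

text \<open>Because addition is strictly monotone, the sum of the two maxima splits over the
  supports in only one way, so its coefficient survives.\<close>

lemma Max_supp_times:
  assumes "a \<noteq> 0" and "b \<noteq> 0"
  shows "Max (supp a) + Max (supp b) \<in> supp (a * b)"
    and "Max (supp (a * b)) = Max (supp a) + Max (supp b)"
proof -
  have le: "M \<le> Max (supp a)" "N \<le> Max (supp b)" if "M \<in> supp a" "N \<in> supp b" for M N
    using that by simp_all
  show in_supp: "Max (supp a) + Max (supp b) \<in> supp (a * b)"
  proof (rule supp_times_unique)
    fix M N assume MN: "M \<in> supp a" "N \<in> supp b" "M + N = Max (supp a) + Max (supp b)"
    then have "\<not> M < Max (supp a)" "\<not> N < Max (supp b)"
      using le[OF MN(1,2)] add_less_le_mono[of M "Max (supp a)" N "Max (supp b)"]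
        add_le_less_mono[of M "Max (supp a)" N "Max (supp b)"] by auto
    then show "M = Max (supp a) \<and> N = Max (supp b)"
      using le[OF MN(1,2)] by auto
  qed (use assms in simp_all)
  show "Max (supp (a * b)) = Max (supp a) + Max (supp b)"
  proof (rule Max_eqI)
    fix K assume "K \<in> supp (a * b)"
    then obtain M N where "M \<in> supp a" "N \<in> supp b" "K = M + N"
      using supp_times by blast
    then show "K \<le> Max (supp a) + Max (supp b)"
      using le by (simp add: add_mono)
  qed (simp_all add: in_supp)
qed

lemma Min_supp_times:
  assumes "a \<noteq> 0" and "b \<noteq> 0"
  shows "Min (supp (a * b)) = Min (supp a) + Min (supp b)"
proof -
  have le: "Min (supp a) \<le> M" "Min (supp b) \<le> N" if "M \<in> supp a" "N \<in> supp b" for M N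
    using that by simp_all
  have in_supp: "Min (supp a) + Min (supp b) \<in> supp (a * b)"
  proof (rule supp_times_unique)
    fix M N assume MN: "M \<in> supp a" "N \<in> supp b" "M + N = Min (supp a) + Min (supp b)"
    then have "\<not> Min (supp a) < M" "\<not> Min (supp b) < N"
      using le[OF MN(1,2)] add_less_le_mono[of "Min (supp a)" M "Min (supp b)" N]
        add_le_less_mono[of "Min (supp a)" M "Min (supp b)" N] by auto
    then show "M = Min (supp a) \<and> N = Min (supp b)"
      using le[OF MN(1,2)] by auto
  qed (use assms in simp_all)
  show ?thesis
  proof (rule Min_eqI)
    fix K assume "K \<in> supp (a * b)"
    then obtain M N where "M \<in> supp a" "N \<in> supp b" "K = M + N"
      using supp_times by blast
    then show "Min (supp a) + Min (supp b) \<le> K"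
      using le by (simp add: add_mono)
  qed (simp_all add: in_supp)
qed

section \<open>Zero divisors, roots of generator powers and irreducibility\<close>

lemma times_eq_zero_iff: "a * b = 0 \<longleftrightarrow> a = 0 \<or> b = 0" for a b :: 's
  by (metis Max_supp_times(1) empty_iff mult_zero_left mult_zero_right supp_empty_iff)

lemma power_nonzero: "a \<noteq> 0 \<Longrightarrow> a ^ n \<noteq> 0" for a :: 's
  by (induction n) (simp_all add: times_eq_zero_iff one_neq_zero)

lemma Max_supp_power: "a \<noteq> 0 \<Longrightarrow> Max (supp (a ^ n)) = repeat_mset n (Max (supp a))"
  by (induction n) (simp_all add: Max_supp_times power_nonzero)

lemma Min_supp_power: "a \<noteq> 0 \<Longrightarrow> Min (supp (a ^ n)) = repeat_mset n (Min (supp a))"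
  by (induction n) (simp_all add: Min_supp_times power_nonzero)

lemma supp_eq_singletonI:
  assumes "a \<noteq> 0" and "Max (supp a) = M" and "Min (supp a) = M"
  shows "supp a = {M}"
proof -
  have "N = M" if "N \<in> supp a" for N
    using that assms Max_ge[of "supp a" N] Min_le[of "supp a" N] by auto
  moreover have "M \<in> supp a"
    using assms Max_in[of "supp a"] by auto
  ultimately show ?thesis by blast
qed

text \<open>Extreme exponents are additive, so \<open>L\<close> times each of them equals
  \<open>L\<close> times \<open>{#i#}\<close>. They coincide, and \<open>a\<close> has a single
  term.\<close>

lemma power_eq_generator_powerD:
  assumes "a ^ L = x i ^ L" and "L > 0"
  shows "\<exists>c. c \<noteq> 0 \<and> a = scale c (x i)"
proof -
  have a: "a \<noteq> 0"
    using assms power_nonzero[OF x_nonzero, of i L] by (auto simp: power_0_left)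
  have "repeat_mset L (Max (supp a)) = repeat_mset L {#i#}"
    using Max_supp_power[OF a, of L] Max_supp_power[OF x_nonzero, of i L] assms by simp
  moreover have "repeat_mset L (Min (supp a)) = repeat_mset L {#i#}"
    using Min_supp_power[OF a, of L] Min_supp_power[OF x_nonzero, of i L] assms by simp
  ultimately have "supp a = {{#i#}}"
    using assms a by (intro supp_eq_singletonI) (simp_all only: repeat_mset_cancel1, simp_all)
  then show ?thesis
    using supp_singletonD[of a "{#i#}"] by simp
qed

text \<open>In each factor the smallest exponent is at most the largest, yet minima and maxima both
  add up to \<open>{#i#}\<close>. So each factor has one term, and one of the two exponents is
  empty.\<close>

lemma generator_irreducible:
  assumes "a * b = x i"
  shows "(\<exists>c. c \<noteq> 0 \<and> a = scale c 1) \<or> (\<exists>c. c \<noteq> 0 \<and> b = scale c 1)"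
proof -
  have nz: "a \<noteq> 0" "b \<noteq> 0"
    using assms x_nonzero[of i] times_eq_zero_iff[of a b] by auto
  have Max: "Max (supp a) + Max (supp b) = {#i#}" and Min: "Min (supp a) + Min (supp b) = {#i#}"
    using Max_supp_times(2)[OF nz] Min_supp_times[OF nz] assms by simp_all
  have le: "Min (supp a) \<le> Max (supp a)" "Min (supp b) \<le> Max (supp b)"
    using nz by simp_all
  then have "\<not> Min (supp a) < Max (supp a)" "\<not> Min (supp b) < Max (supp b)"
    using Max Min add_less_le_mono[of "Min (supp a)" "Max (supp a)" "Min (supp b)" "Max (supp b)"]
      add_le_less_mono[of "Min (supp a)" "Max (supp a)" "Min (supp b)" "Max (supp b)"] by fastforce+
  then have "Min (supp a) = Max (supp a)" "Min (supp b) = Max (supp b)"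
    using le le_neq_trans by blast+
  then have eq: "supp a = {Max (supp a)}" "supp b = {Max (supp b)}"
    using supp_eq_singletonI[OF nz(1) refl] supp_eq_singletonI[OF nz(2) refl] by blast+
  from Max have "Max (supp a) = {#} \<or> Max (supp b) = {#}"
    by (auto simp: union_is_single)
  then show ?thesis
  proof
    assume "Max (supp a) = {#}"
    then have "supp a = {{#}}" using eq(1) by metis
    then show ?thesis using supp_singletonD[of a "{#}"] by simp
  next
    assume "Max (supp b) = {#}"
    then have "supp b = {{#}}" using eq(2) by metis
    then show ?thesis using supp_singletonD[of b "{#}"] by simp
  qed
qed

subsection \<open>Center and divisibility by generators\<close>

text \<open>Compare coefficients at \<open>M + N\<close> in \<open>z * mon N = mon N * z\<close>. On
  either side only the term \<open>M\<close> of \<open>z\<close> contributes, as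
  \<open>mon N\<close> has a single term.\<close>

lemma twist_commute_if_central:
  assumes "z \<in> center" and "M \<in> supp z"
  shows "twist M N = twist N M"
proof -
  have "coef (mon N * z) (N + M) = coef (mon N) N * coef z M * twist N M"
    using assms by (intro coef_times_unique) auto
  moreover have "coef (z * mon N) (M + N) = coef z M * coef (mon N) N * twist M N"
    using assms by (intro coef_times_unique) auto
  moreover have "z * mon N = mon N * z"
    using assms unfolding center_def by blast
  ultimately show ?thesis
    using assms(2) by (simp add: add.commute coef_mon supp_def)
qed

lemma central_if_commutes_mon:
  assumes "\<And>M. z * mon M = mon M * z"
  shows "z \<in> center"
proof -
  have "z * a = a * z" for a
  proof -
    have "z * (\<Sum>M\<in>supp a. scale (coef a M) (mon M)) = (\<Sum>M\<in>supp a. scale (coef a M) (mon M)) * z"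
      by (simp add: sum_distrib_left sum_distrib_right assms flip: scale_mult_left scale_mult_right)
    then show ?thesis by (simp flip: mon_expansion)
  qed
  then show ?thesis by (simp add: center_def)
qed

lemma central_if_commutes_generators:
  assumes "\<And>i. z * x i = x i * z"
  shows "z \<in> center"
proof -
  have "z * prod_list (map x w) = prod_list (map x w) * z" for w
  proof (induction w)
    case (Cons i w)
    have "z * (x i * prod_list (map x w)) = x i * (z * prod_list (map x w))"
      by (metis assms mult.assoc)
    then show ?case using Cons by (simp add: mult.assoc)
  qed simp
  then show ?thesis
    by (intro central_if_commutes_mon) (simp add: mon_def)
qed

text \<open>The commutation condition holds for each term of a central element, so the center is
  spanned by the monomials it contains.\<close>

lemma mon_central_if_central:
  assumes "z \<in> center" and "M \<in> supp z"
  shows "mon M \<in> center"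
  by (intro central_if_commutes_mon)
    (simp add: mon_times add.commute twist_commute_if_central[OF assms])

lemma scale_central_iff: "c \<noteq> 0 \<Longrightarrow> scale c z \<in> center \<longleftrightarrow> z \<in> center"
  by (auto simp: center_def simp flip: scale_mult_left scale_mult_right)

lemma power_mon: "\<exists>c. c \<noteq> 0 \<and> x i ^ m = scale c (mon (replicate_mset m i))"
proof -
  have "x i ^ m = prod_list (map x (replicate m i))"
    by (simp add: prod_list_replicate)
  then show ?thesis
    using word_eq_mon[of "replicate m i"] inversion_weight_nonzero[OF antisymmetric]
    by (metis mset_replicate)
qed

text \<open>Links exponents with a purely multiplicative condition, so that the exponent of
  \<open>x i\<close> can be expressed without the monomial basis.\<close>

lemma generator_power_dvd_iff:
  "(\<exists>u. z = x i ^ m * u) \<longleftrightarrow> (\<forall>M\<in>supp z. m \<le> count M i)"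
proof -
  obtain c where c: "c \<noteq> 0" "x i ^ m = scale c (mon (replicate_mset m i))"
    using power_mon by blast
  show ?thesis
  proof
    assume "\<exists>u. z = x i ^ m * u"
    then show "\<forall>M\<in>supp z. m \<le> count M i"
      using c supp_times by fastforce
  next
    assume m: "\<forall>M\<in>supp z. m \<le> count M i"
    let ?R = "replicate_mset m i"
    \<comment> \<open>Each term of \<open>z\<close> is divided separately; the denominator undoes
      the scalars from writing \<open>x i ^ m\<close> as a monomial and from multiplying
      monomials.\<close>
    define u where "u = (\<Sum>M\<in>supp z. scale (coef z M / (twist ?R (M - ?R) * c)) (mon (M - ?R)))"
    have "x i ^ m * u = (\<Sum>M\<in>supp z. scale (coef z M) (mon M))"
      unfolding u_def sum_distrib_left
    proof (intro sum.cong refl)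
      fix M assume "M \<in> supp z"
      then have "?R \<subseteq># M"
        using m by (simp add: count_le_replicate_mset_subset_eq)
      then show "x i ^ m * scale (coef z M / (twist ?R (M - ?R) * c)) (mon (M - ?R)) =
          scale (coef z M) (mon M)"
        using c by (simp add: mon_times flip: scale_mult_left scale_mult_right)
    qed
    then show "\<exists>u. z = x i ^ m * u"
      by (metis mon_expansion)
  qed
qed

text \<open>\<open>x j\<close> commutes with every monomial up to a nonzero scalar; \<open>b\<close>
  absorbs these scalars into the coefficients of \<open>a\<close>.\<close>

lemma generator_normal: "\<exists>b. x j * a = b * x j"
proof -
  define b where
    "b = (\<Sum>M\<in>supp a. scale (coef a M * twist {#j#} M / twist M {#j#}) (mon M))"
  have "x j * a = mon {#j#} * (\<Sum>M\<in>supp a. scale (coef a M) (mon M))"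
    by (simp flip: mon_expansion)
  also have "\<dots> = b * mon {#j#}"
    unfolding b_def sum_distrib_left sum_distrib_right
    by (intro sum.cong refl) (simp add: mon_times flip: scale_mult_left scale_mult_right del: mon_single)
  finally show ?thesis by auto
qed

text \<open>Later it shows that a nontrivial reflection in one presentation must move a generator of
  the other.\<close>

lemma hom_eq_id:
  assumes "\<And>a b. g (a + b) = g a + g b" and "\<And>c a. g (scale c a) = scale c (g a)"
    and "\<And>a b. g (a * b) = g a * g b" and "g 1 = 1" and "\<And>i. g (x i) = x i"
  shows "g a = a"
proof -
  have "g 0 = 0"
    using assms(2)[of 0 0] by simp
  have sum: "g (\<Sum>M\<in>A. f M) = (\<Sum>M\<in>A. g (f M))" for A and f :: "'n multiset \<Rightarrow> 's"
    by (induction A rule: infinite_finite_induct) (simp_all add: assms \<open>g 0 = 0\<close>)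
  have "g (prod_list (map x w)) = prod_list (map x w)" for w
    by (induction w) (simp_all add: assms)
  then have "g (\<Sum>M\<in>supp a. scale (coef a M) (mon M)) = (\<Sum>M\<in>supp a. scale (coef a M) (mon M))"
    by (simp add: sum assms mon_def)
  then show ?thesis by (simp flip: mon_expansion)
qed

subsection \<open>Reflections\<close>

text \<open>Acting diagonally on the monomial basis gives linearity at once; for \<zeta> \<noteq> 0
  multiplicativity follows since multiplicities of \<open>i\<close> add under products.\<close>

definition reflection :: "'n \<Rightarrow> 'k \<Rightarrow> 's \<Rightarrow> 's"
  where "reflection i \<zeta> a = (\<Sum>M\<in>supp a. scale (\<zeta> ^ count M i * coef a M) (mon M))"

lemma coef_reflection: "coef (reflection i \<zeta> a) M = \<zeta> ^ count M i * coef a M"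
  unfolding reflection_def coef_combination[OF finite_supp] by (simp add: supp_def)

lemma supp_reflection: "\<zeta> \<noteq> 0 \<Longrightarrow> supp (reflection i \<zeta> a) = supp a"
  by (simp add: supp_def coef_reflection)

lemma reflection_add: "reflection i \<zeta> (a + b) = reflection i \<zeta> a + reflection i \<zeta> b"
  by (rule coef_eqI) (simp add: coef_reflection coef_add distrib_left)

lemma reflection_scale: "reflection i \<zeta> (scale c a) = scale c (reflection i \<zeta> a)"
  by (rule coef_eqI) (simp add: coef_reflection coef_scale)

lemma reflection_one: "reflection i \<zeta> 1 = 1"
  using coef_mon[of "{#}"] by (intro coef_eqI) (simp add: coef_reflection)

lemma reflection_generator: "reflection i \<zeta> (x i) = scale \<zeta> (x i)"
  using coef_mon[of "{#i#}"] by (intro coef_eqI) (auto simp: coef_reflection coef_scale)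

lemma reflection_times:
  assumes "\<zeta> \<noteq> 0"
  shows "reflection i \<zeta> (a * b) = reflection i \<zeta> a * reflection i \<zeta> b"
  by (rule coef_eqI)
    (auto simp: coef_reflection coef_times supp_reflection[OF assms] sum_distrib_left power_add
      intro!: sum.cong)

lemma reflection_power:
  "\<zeta> \<noteq> 0 \<Longrightarrow> reflection i \<zeta> (a ^ n) = reflection i \<zeta> a ^ n"
  by (induction n) (simp_all add: reflection_one reflection_times)

text \<open>Terms free of \<open>x i\<close> are fixed and cancel in the difference; all others are
  divisible by \<open>x i\<close>.\<close>

lemma reflection_diff: "\<exists>u. reflection i \<zeta> a - a = x i * u"
proof -
  have "\<forall>M\<in>supp (reflection i \<zeta> a - a). 1 \<le> count M i"
    by (auto simp: supp_def coef_diff coef_reflection Suc_le_eq) (metis not_in_iff power_0)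
  then show ?thesis
    using generator_power_dvd_iff[of _ i 1] by simp
qed

end

section \<open>Ozone exponents as valuations\<close>

text \<open>These valuations mention only the ring and \<open>y\<close>, no presentation. This makes
  their gcd comparable across generating families.\<close>

definition central_valuations :: "'s::ring_1 \<Rightarrow> nat set"
  where "central_valuations y =
    {m. \<exists>z\<in>center. z \<noteq> 0 \<and> (\<exists>u. z = y ^ m * u) \<and> \<not> (\<exists>u. z = y ^ Suc m * u)}"

lemma (in assoc_algebra) power_scale: "scale c a ^ n = scale (c ^ n) (a ^ n)"
  by (induction n) (simp_all flip: scale_mult_left scale_mult_right add: mult.commute)

lemma (in assoc_algebra) central_valuations_scale:
  assumes "c \<noteq> 0"
  shows "central_valuations (scale c y) = central_valuations y"
proof -
  have "(\<exists>u. z = scale c y ^ m * u) \<longleftrightarrow> (\<exists>u. z = y ^ m * u)" for z m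
  proof
    assume "\<exists>u. z = scale c y ^ m * u"
    then show "\<exists>u. z = y ^ m * u"
      by (metis power_scale scale_mult_left scale_mult_right)
  next
    assume "\<exists>u. z = y ^ m * u"
    then obtain u where "z = y ^ m * u" by blast
    then have "z = scale c y ^ m * scale (inverse (c ^ m)) u"
      using assms by (simp add: power_scale flip: scale_mult_left scale_mult_right)
    then show "\<exists>u. z = scale c y ^ m * u" by blast
  qed
  then show ?thesis by (simp only: central_valuations_def)
qed

lemma (in assoc_algebra) skew_commute_power_left:
  assumes "y * a = scale c (a * y)"
  shows "y ^ n * a = scale (c ^ n) (a * y ^ n)"
proof (induction n)
  case (Suc n)
  have "y ^ Suc n * a = y ^ n * (y * a)"
    by (simp add: power_commutes mult.assoc[symmetric])
  also have "\<dots> = scale c (y ^ n * a * y)"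
    using assms by (simp add: mult.assoc flip: scale_mult_right)
  also have "\<dots> = scale (c ^ Suc n) (a * y ^ Suc n)"
    by (simp add: Suc mult.assoc power_commutes flip: scale_mult_left scale_mult_right)
  finally show ?case .
qed simp

definition word :: "('n::{finite,linorder} \<Rightarrow> nat) \<Rightarrow> 'n list"
  where "word d = concat (map (\<lambda>i. replicate (d i) i) (sorted_list_of_set UNIV))"

lemma monomial_eq_word: "monomial x d = prod_list (map x (word d))"
proof -
  have "prod_list (map x (concat (map (\<lambda>i. replicate (d i) i) l))) =
      prod_list (map (\<lambda>i. x i ^ d i) l)" for l
    by (induction l) (simp_all add: prod_list_replicate)
  then show ?thesis by (simp add: monomial_def word_def)
qed

lemma count_word: "count (mset (word d)) i = d i"
proof -
  have "distinct l \<Longrightarrow>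
      count (mset (concat (map (\<lambda>i. replicate (d i) i) l))) i = (if i \<in> set l then d i else 0)" for l
    by (induction l) auto
  then show ?thesis by (simp add: word_def)
qed

context skew_polynomial
begin

lemma monomial_eq_mon: "\<exists>c. c \<noteq> 0 \<and> monomial x d = scale c (mon (mset (word d)))"
  using word_eq_mon[of "word d"] inversion_weight_nonzero[OF antisymmetric, of "word d"]
  by (auto simp: monomial_eq_word)

lemma central_exponents_eq: "{d i | d. monomial x d \<in> center} = {count M i | M. mon M \<in> center}"
proof -
  have iff: "monomial x d \<in> center \<longleftrightarrow> mon (mset (word d)) \<in> center" for d
    using monomial_eq_mon[of d] scale_central_iff by metis
  have "mset (word (count M)) = M" for M :: "'n multiset"
    by (rule multiset_eqI) (simp add: count_word)
  then have "monomial x (count M) \<in> center" if "mon M \<in> center" for M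
    using that by (simp add: iff)
  then show ?thesis
    using iff count_word by (smt (verit) Collect_cong)
qed

text \<open>A central element of valuation \<open>m\<close> has a term in which \<open>x i\<close>
  occurs exactly \<open>m\<close> times, and the monomial of that term is itself central.\<close>

lemma central_valuations_eq: "central_valuations (x i) = {count M i | M. mon M \<in> center}"
proof (intro equalityI subsetI)
  fix m assume "m \<in> central_valuations (x i)"
  then obtain z where z: "z \<in> center" "\<forall>M\<in>supp z. m \<le> count M i"
      "\<not> (\<forall>M\<in>supp z. Suc m \<le> count M i)"
    unfolding central_valuations_def generator_power_dvd_iff by blast
  then obtain M where M: "M \<in> supp z" "\<not> Suc m \<le> count M i"
    by blast
  then have "count M i = m"
    using z(2) by (simp add: le_antisym not_less_eq_eq)
  then show "m \<in> {count M i | M. mon M \<in> center}"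
    using mon_central_if_central[OF z(1) M(1)] by blast
next
  fix m assume "m \<in> {count M i | M. mon M \<in> center}"
  then obtain M where M: "mon M \<in> center" "m = count M i" by blast
  have "mon M \<noteq> 0"
    by (metis insert_not_empty supp_empty_iff supp_mon)
  with M show "m \<in> central_valuations (x i)"
    unfolding central_valuations_def generator_power_dvd_iff by auto
qed

lemma ozone_exponent_eq: "ozone_exponent x i = Gcd (central_valuations (x i))"
  by (simp add: ozone_exponent_def central_exponents_eq central_valuations_eq)

lemma ozone_exponent_dvd_count:
  assumes "z \<in> center" and "M \<in> supp z"
  shows "ozone_exponent x i dvd count M i"
  unfolding ozone_exponent_eq central_valuations_eq
  by (rule Gcd_dvd) (use mon_central_if_central[OF assms] in blast)

lemma ozone_exponent_dvd:
  assumes "x i ^ L \<in> center"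
  shows "ozone_exponent x i dvd L"
proof -
  obtain c where "c \<noteq> 0" "x i ^ L = scale c (mon (replicate_mset L i))"
    using power_mon by blast
  then show ?thesis
    using ozone_exponent_dvd_count[OF assms, of "replicate_mset L i" i] by simp
qed

lemma reflection_central:
  assumes "z \<in> center" and "q dvd ozone_exponent x i" and "\<zeta> ^ q = 1"
  shows "reflection i \<zeta> z = z"
proof (rule coef_eqI)
  fix M
  show "coef (reflection i \<zeta> z) M = coef z M"
  proof (cases "M \<in> supp z")
    case True
    then have "q dvd count M i"
      using assms ozone_exponent_dvd_count dvd_trans by blast
    then have "\<zeta> ^ count M i = 1"
      using assms(3) by (auto simp: power_mult)
    then show ?thesis by (simp add: coef_reflection)
  qed (simp add: coef_reflection supp_def)
qed

lemma generator_power_central: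
  assumes "\<And>i j. p i j ^ L = 1"
  shows "x j ^ L \<in> center"
  using skew_commute_power_left[OF skew_commute[of j], of L] assms
  by (intro central_if_commutes_generators) simp

lemma generator_not_scalar: "x i \<noteq> scale c 1"
proof
  assume "x i = scale c 1"
  then have "coef (x i) {#i#} = c * coef 1 {#i#}"
    by (simp add: coef_scale)
  then show False
    using coef_mon[of "{#i#}" "{#i#}"] coef_mon[of "{#}" "{#i#}"] by simp
qed

lemma generator_eq_scale_generatorD:
  assumes "x i = scale c (x j)"
  shows "i = j"
proof (rule ccontr)
  assume "i \<noteq> j"
  have "coef (x i) {#i#} = c * coef (x j) {#i#}"
    unfolding assms by (rule coef_scale)
  then show False
    using coef_mon[of "{#i#}" "{#i#}"] coef_mon[of "{#j#}" "{#i#}"] \<open>i \<noteq> j\<close> by simp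
qed

end

section \<open>Comparing two presentations\<close>

text \<open>In the main result roots of unity are assumed for \<open>p\<close>; this carries the
  resulting central powers over to the second family.\<close>

lemma generator_power_central_transfer:
  assumes "skew_polynomial scale p x" and "skew_polynomial scale p' x'"
    and "L > 0" and central: "\<And>i. x i ^ L \<in> center"
  shows "x' j ^ L \<in> center"
proof -
  interpret A: skew_polynomial scale p x by fact
  interpret B: skew_polynomial scale p' x' by fact
  have "x' j ^ L * x i = x i * x' j ^ L" for i
  proof -
    obtain b where b: "x' j * x i = b * x' j"
      using B.generator_normal by blast
    have "x' j * x i ^ n = b ^ n * x' j" for n
    proof (induction n)
      case (Suc n)
      have "x' j * x i ^ Suc n = b * (x' j * x i ^ n)"
        using b by (simp flip: mult.assoc)
      then show ?case using Suc by (simp add: mult.assoc)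
    qed simp
    \<comment> \<open>Centrality of \<open>x i ^ L\<close> lets it pass \<open>x' j\<close>;
      cancelling \<open>x' j\<close> in the domain then gives
      \<open>b ^ L = x i ^ L\<close>.\<close>
    then have pow: "b ^ L * x' j = x i ^ L * x' j"
      using central[of i] by (metis (mono_tags, lifting) center_def mem_Collect_eq)
    then have "(b ^ L - x i ^ L) * x' j = 0"
      by (simp add: left_diff_distrib)
    then have eq: "b ^ L = x i ^ L"
      using B.x_nonzero B.times_eq_zero_iff by auto
    then obtain c where c: "b = scale c (x i)"
      using A.power_eq_generator_powerD \<open>L > 0\<close> by blast
    have "scale (c ^ L) (x i ^ L) = scale 1 (x i ^ L)"
      using eq c by (simp add: A.power_scale)
    then have "c ^ L = 1"
      using A.power_nonzero[OF A.x_nonzero] by (metis A.scale_right_imp_eq)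
    moreover have "x' j * x i = scale c (x i * x' j)"
      using b c by (simp add: A.scale_mult_left)
    ultimately show ?thesis
      using A.skew_commute_power_left[of "x' j" "x i" c L] by simp
  qed
  then show ?thesis by (rule A.central_if_commutes_generators)
qed

lemma reflected_generator_transfer:
  fixes scale :: "'k::field \<Rightarrow> 's::ring_1 \<Rightarrow> 's" and \<zeta> :: 'k
  assumes "skew_polynomial scale p x" and "skew_polynomial scale p' x'"
    and "L > 0" and central: "\<And>j. x' j ^ L \<in> center"
    and q: "q dvd ozone_exponent x i" and \<zeta>: "\<zeta> ^ q = 1" "\<zeta> \<noteq> 1" and "q > 0"
  shows "\<exists>j c. c \<noteq> 0 \<and> x' j = scale c (x i)"
proof -
  interpret A: skew_polynomial scale p x by fact
  interpret B: skew_polynomial scale p' x' by fact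
  let ?g = "A.reflection i \<zeta>"
  have [simp]: "\<zeta> \<noteq> 0"
    using \<zeta>(1) \<open>q > 0\<close> by (auto simp: power_0_left)
  \<comment> \<open>\<open>x' j ^ L\<close> is central, hence fixed by the reflection, so
    \<open>?g (x' j)\<close> and \<open>x' j\<close> have the same \<open>L\<close>-th
    power.\<close>
  have "\<exists>c. c \<noteq> 0 \<and> ?g (x' j) = scale c (x' j)" for j
  proof -
    have "?g (x' j) ^ L = x' j ^ L"
      using A.reflection_central[OF central q \<zeta>(1)] A.reflection_power by simp
    then show ?thesis
      using B.power_eq_generator_powerD \<open>L > 0\<close> by blast
  qed
  then obtain c where c: "\<And>j. ?g (x' j) = scale (c j) (x' j)"
    by metis
  have "\<exists>j. c j \<noteq> 1"
  proof (rule ccontr)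
    assume "\<not> ?thesis"
    then have fixed: "?g (x' j) = x' j" for j
      using c[of j] by simp
    have "?g (x i) = x i"
      by (rule B.hom_eq_id[where g = ?g, OF A.reflection_add A.reflection_scale
            A.reflection_times[OF \<open>\<zeta> \<noteq> 0\<close>] A.reflection_one fixed])
    then have "scale \<zeta> (x i) = scale 1 (x i)"
      by (simp add: A.reflection_generator)
    then show False
      using \<zeta>(2) A.x_nonzero by (metis A.scale_right_imp_eq)
  qed
  then obtain j where j: "c j - 1 \<noteq> 0" by auto
  obtain u where "?g (x' j) - x' j = x i * u"
    using A.reflection_diff by blast
  \<comment> \<open>\<open>x' j\<close> is an eigenvector with eigenvalue different from 1, so
    divisibility of the difference by \<open>x i\<close> passes to \<open>x' j\<close>.\<close>
  then have "scale (c j - 1) (x' j) = x i * u"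
    by (simp add: c A.scale_left_diff_distrib)
  then have "scale (1 / (c j - 1)) (x i * u) = x' j"
    using j by (metis A.scale_one A.scale_scale nonzero_eq_divide_eq)
  then have "x i * scale (1 / (c j - 1)) u = x' j"
    by (simp add: A.scale_mult_right)
  \<comment> \<open>\<open>x' j\<close> is irreducible and the factor \<open>x i\<close> is not a
    scalar, so the cofactor is one.\<close>
  then obtain e where "e \<noteq> 0" "scale (1 / (c j - 1)) u = scale e 1"
    using B.generator_irreducible A.generator_not_scalar by blast
  then have "x' j = scale e (x i)"
    using \<open>x i * _ = x' j\<close> by (simp flip: A.scale_mult_right)
  then show ?thesis using \<open>e \<noteq> 0\<close> by blast
qed

text \<open>Matched letters differ by scalars, and restoring the increasing order in the second
  family costs another one. Letters where \<open>d\<close> vanishes do not occur in the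
  word.\<close>

lemma monomial_reindex:
  assumes "skew_polynomial scale p x" and "skew_polynomial scale p' x'"
    and "bij \<pi>" and d: "\<And>i. d' (\<pi> i) = d i"
    and "\<And>i. d i \<noteq> 0 \<Longrightarrow> \<exists>c. c \<noteq> 0 \<and> x' (\<pi> i) = scale c (x i)"
  shows "\<exists>c. c \<noteq> 0 \<and> monomial x' d' = scale c (monomial x d)"
proof -
  interpret A: skew_polynomial scale p x by fact
  interpret B: skew_polynomial scale p' x' by fact
  have "mset (map \<pi> (word d)) = mset (word d')"
  proof (rule multiset_eqI)
    fix j
    obtain i where i: "j = \<pi> i"
      using \<open>bij \<pi>\<close> by (metis bij_pointE)
    have "count (image_mset \<pi> M) (\<pi> i) = count M i" for M
      using inj_eq[OF bij_is_inj[OF \<open>bij \<pi>\<close>]] by (induction M) auto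
    then show "count (mset (map \<pi> (word d))) j = count (mset (word d')) j"
      by (simp add: i count_word d)
  qed
  then have word: "prod_list (map x' (map \<pi> (word d))) =
      scale (inversion_weight p' (map \<pi> (word d))) (B.mon (mset (word d')))"
    using B.word_eq_mon[of "map \<pi> (word d)"] by (simp only:)
  obtain b where b: "b \<noteq> 0" "monomial x' d' = scale b (B.mon (mset (word d')))"
    using B.monomial_eq_mon by blast
  have nz: "inversion_weight p' (map \<pi> (word d)) \<noteq> 0"
    by (rule inversion_weight_nonzero[OF B.antisymmetric])
  have "set w \<subseteq> {i. d i \<noteq> 0} \<Longrightarrow>
      \<exists>c. c \<noteq> 0 \<and> prod_list (map x' (map \<pi> w)) = scale c (prod_list (map x w))" for w
  proof (induction w)
    case Nil
    then show ?case by (intro exI[of _ 1]) simp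
  next
    case (Cons i w)
    then obtain c e where "c \<noteq> 0" "prod_list (map x' (map \<pi> w)) = scale c (prod_list (map x w))"
        "e \<noteq> 0" "x' (\<pi> i) = scale e (x i)"
      using assms(5)[of i] by auto
    then show ?case
      by (intro exI[of _ "e * c"]) (simp flip: A.scale_mult_left A.scale_mult_right add: mult.commute)
  qed
  moreover have "set (word d) \<subseteq> {i. d i \<noteq> 0}"
    by (auto simp: word_def)
  ultimately obtain c where c: "c \<noteq> 0"
      "prod_list (map x' (map \<pi> (word d))) = scale c (monomial x d)"
    unfolding monomial_eq_word by blast
  let ?v = "inversion_weight p' (map \<pi> (word d))"
  have "monomial x' d' = scale (b / ?v) (scale ?v (B.mon (mset (word d'))))"
    using b nz by simp
  also have "\<dots> = scale (b / ?v * c) (monomial x d)"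
    using word c by simp
  finally show ?thesis
    using b c nz by (intro exI[of _ "b / ?v * c"]) simp
qed

text \<open>The \<open>LEAST\<close> is the order of \<open>a\<close>. Writing it as
  \<open>q * r\<close>, the power \<open>a ^ r\<close> is not 1 because \<open>r\<close> is smaller
  than the order.\<close>

lemma prime_root_of_unity:
  fixes a :: "'k::field"
  assumes "prime q" and "q dvd (LEAST m. m > 0 \<and> a ^ m = 1)" and "m > 0" and "a ^ m = 1"
  shows "\<exists>\<zeta>::'k. \<zeta> ^ q = 1 \<and> \<zeta> \<noteq> 1"
proof -
  define k where "k = (LEAST m. m > 0 \<and> a ^ m = 1)"
  have k: "k > 0" "a ^ k = 1"
    using LeastI[of "\<lambda>m. m > 0 \<and> a ^ m = 1" m] assms by (simp_all add: k_def)
  obtain r where r: "k = q * r"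
    using assms(2) by (auto simp: k_def)
  have "q > 1" using assms(1) by (rule prime_gt_1_nat)
  then have "r > 0" "r < k" using k r by auto
  then have "a ^ r \<noteq> 1"
    using not_less_Least[of r "\<lambda>m. m > 0 \<and> a ^ m = 1"] by (auto simp: k_def)
  moreover have "(a ^ r) ^ q = 1"
    using k r by (simp add: mult.commute flip: power_mult)
  ultimately show ?thesis by blast
qed

lemma generators_of_nontrivial_exponent_transfer:
  fixes scale :: "'k::field \<Rightarrow> 's::ring_1 \<Rightarrow> 's"
  assumes "skew_polynomial scale p x" and "skew_polynomial scale p' x'"
    and "L > 0" and "\<And>i. x i ^ L \<in> center" and "\<And>j. x' j ^ L \<in> center"
    and roots: "\<And>q. prime q \<Longrightarrow> q dvd L \<Longrightarrow> \<exists>\<zeta>::'k. \<zeta> ^ q = 1 \<and> \<zeta> \<noteq> 1"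
    and "ozone_exponent x i > 1"
  shows "\<exists>j c. c \<noteq> 0 \<and> x' j = scale c (x i)"
proof -
  interpret A: skew_polynomial scale p x by fact
  obtain q where q: "prime q" "q dvd ozone_exponent x i"
    using assms(7) prime_factor_nat[of "ozone_exponent x i"] by auto
  then have "q dvd L"
    using A.ozone_exponent_dvd assms(4) dvd_trans by blast
  then obtain \<zeta> :: 'k where "\<zeta> ^ q = 1" "\<zeta> \<noteq> 1"
    using roots q by blast
  then show ?thesis
    using reflected_generator_transfer[OF assms(1-3,5) q(2)] q(1) prime_gt_0_nat by blast
qed

text \<open>\<open>R\<close> pairs off the indices with value above 1. The remaining indices are
  equally many on both sides and all have value 1, so any bijection between them completes the
  pairing.\<close>

lemma bij_extending_matching:
  fixes f f' :: "'n::finite \<Rightarrow> nat"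
  assumes pos: "\<And>i. f i \<ge> 1" "\<And>j. f' j \<ge> 1"
    and R: "\<And>i j. R i j \<Longrightarrow> f' j = f i"
    and left: "\<And>i. f i > 1 \<Longrightarrow> \<exists>j. R i j" and right: "\<And>j. f' j > 1 \<Longrightarrow> \<exists>i. R i j"
    and inj: "\<And>i k j. R i j \<Longrightarrow> R k j \<Longrightarrow> i = k" "\<And>i j k. R i j \<Longrightarrow> R i k \<Longrightarrow> j = k"
  shows "\<exists>\<pi>. bij \<pi> \<and> (\<forall>i. f' (\<pi> i) = f i) \<and> (\<forall>i. f i > 1 \<longrightarrow> R i (\<pi> i))"
proof -
  define A where "A = {i. f i > 1}"
  define B where "B = {j. f' j > 1}"
  obtain \<tau> where \<tau>: "\<And>i. i \<in> A \<Longrightarrow> R i (\<tau> i)"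
    using left unfolding A_def by (metis mem_Collect_eq)
  have "bij_betw \<tau> A B"
  proof (rule bij_betw_imageI)
    show "inj_on \<tau> A"
      by (rule inj_onI) (metis \<tau> inj(1))
    show "\<tau> ` A = B"
    proof (intro equalityI subsetI)
      fix j assume "j \<in> B"
      then obtain i where "R i j" using right by (auto simp: B_def)
      moreover from this have "i \<in> A" using R \<open>j \<in> B\<close> by (simp add: A_def B_def)
      ultimately show "j \<in> \<tau> ` A" using \<tau> inj(2) by blast
    next
      fix j assume "j \<in> \<tau> ` A"
      then show "j \<in> B" using \<tau> R by (force simp: A_def B_def)
    qed
  qed
  moreover from this have "card (- A) = card (- B)"
    by (simp add: bij_betw_same_card Compl_eq_Diff_UNIV card_Diff_subset)
  then obtain \<sigma> where "bij_betw \<sigma> (- A) (- B)"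
    using finite_same_card_bij[of "- A" "- B"] by auto
  ultimately have "bij_betw (\<lambda>i. if i \<in> A then \<tau> i else \<sigma> i) (A \<union> - A) (B \<union> - B)"
    by (intro bij_betw_disjoint_Un) auto
  moreover have "f' (\<sigma> i) = f i" if "i \<notin> A" for i
  proof -
    have "\<sigma> i \<notin> B"
      using \<open>bij_betw \<sigma> _ _\<close> that by (auto simp: bij_betw_def)
    then have "f' (\<sigma> i) = 1"
      using pos(2)[of "\<sigma> i"] by (simp add: B_def)
    then show ?thesis
      using pos(1)[of i] that by (simp add: A_def)
  qed
  ultimately show ?thesis
    using \<tau> R by (intro exI[of _ "\<lambda>i. if i \<in> A then \<tau> i else \<sigma> i"]) (auto simp: A_def)
qed

theorem proposition1p8:
  fixes scale :: "'k::field_char_0 \<Rightarrow> 's::ring_1 \<Rightarrow> 's"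
    and p p' :: "'n::{finite,linorder} \<Rightarrow> 'n \<Rightarrow> 'k"
    and x x' :: "'n \<Rightarrow> 's"
  assumes algebra: "assoc_algebra scale"
    and pres: "skew_presentation scale p x"
    and roots_of_unity: "\<forall>i j. \<exists>m>0. p i j ^ m = 1"
    and noncommutative: "\<exists>a b :: 's. a * b \<noteq> b * a"
    and pres': "skew_presentation scale p' x'"
  shows "(\<exists>c. c \<noteq> 0 \<and> ozone_jacobian x' = scale c (ozone_jacobian x)) \<and>
    (\<exists>c. c \<noteq> 0 \<and> ozone_arrangement x' = scale c (ozone_arrangement x)) \<and>
    (\<exists>c. c \<noteq> 0 \<and> ozone_discriminant x' = scale c (ozone_discriminant x)) \<and>
    image_mset (ozone_exponent x') (mset_set UNIV) = image_mset (ozone_exponent x) (mset_set UNIV)"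
proof -
  have sp: "skew_polynomial scale p x" and sp': "skew_polynomial scale p' x'"
    using algebra pres pres' by (simp_all add: skew_polynomial_def skew_polynomial_axioms_def)
  interpret A: skew_polynomial scale p x by fact
  interpret B: skew_polynomial scale p' x' by fact
  let ?f = "ozone_exponent x" and ?f' = "ozone_exponent x'"
  define k where "k i j = (LEAST m. m > 0 \<and> p i j ^ m = 1)" for i j
  have k: "k i j > 0 \<and> p i j ^ k i j = 1" for i j
    unfolding k_def using roots_of_unity LeastI_ex[of "\<lambda>m. m > 0 \<and> p i j ^ m = 1"] by blast
  \<comment> \<open>With the product of the orders as common exponent, each prime divisor of
    \<open>L\<close> divides some order, so the field contains a nontrivial root of unity for
    it.\<close>
  define L where "L = (\<Prod>(i, j)\<in>UNIV. k i j)"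
  have "L > 0"
    using k by (auto simp: L_def intro!: prod_pos)
  have "k i j dvd L" for i j
    using dvd_prodI[of "UNIV :: ('n \<times> 'n) set" "(i, j)" "\<lambda>(i, j). k i j"] by (simp add: L_def)
  then have "p i j ^ L = 1" for i j
    using k by (metis dvdE power_mult power_one)
  then have central: "x i ^ L \<in> center" for i
    by (rule A.generator_power_central)
  have central': "x' j ^ L \<in> center" for j
    using generator_power_central_transfer[OF sp sp' \<open>L > 0\<close> central] .
  have roots: "\<exists>\<zeta>::'k. \<zeta> ^ q = 1 \<and> \<zeta> \<noteq> 1" if q: "prime q" "q dvd L" for q
  proof -
    obtain i j where "q dvd k i j"
      using q prime_dvd_prod_iff[of UNIV q "\<lambda>(i, j). k i j"] by (auto simp: L_def)
    then show ?thesis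
      using prime_root_of_unity[OF q(1)] k unfolding k_def by blast
  qed
  define R where "R i j \<longleftrightarrow> (\<exists>c. c \<noteq> 0 \<and> x' j = scale c (x i))" for i j
  have R_sym: "R i j" if "c \<noteq> 0" "x i = scale c (x' j)" for i j c
    unfolding R_def using that by (intro exI[of _ "inverse c"]) simp
  \<comment> \<open>An ozone exponent divides the positive \<open>L\<close>, which excludes the
    value 0 that \<open>Gcd\<close> takes on \<open>{0}\<close>.\<close>
  have pos: "1 \<le> ?f i" "1 \<le> ?f' i" for i
    using A.ozone_exponent_dvd[OF central] B.ozone_exponent_dvd[OF central'] \<open>L > 0\<close>
    by (metis One_nat_def Suc_leI dvd_0_left_iff gr0I less_numeral_extra(3))+
  obtain \<pi> where \<pi>: "bij \<pi>" "\<And>i. ?f' (\<pi> i) = ?f i" "\<And>i. ?f i > 1 \<Longrightarrow> R i (\<pi> i)"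
  proof -
    have 1: "?f' j = ?f i" if "R i j" for i j
      using that unfolding R_def A.ozone_exponent_eq B.ozone_exponent_eq
      by (auto simp: A.central_valuations_scale)
    have 2: "\<exists>j. R i j" if "?f i > 1" for i
      using generators_of_nontrivial_exponent_transfer[OF sp sp' \<open>L > 0\<close> central central' roots that]
      unfolding R_def .
    have 3: "\<exists>i. R i j" if "?f' j > 1" for j
      using generators_of_nontrivial_exponent_transfer[OF sp' sp \<open>L > 0\<close> central' central roots that]
        R_sym by blast
    have 4: "i = l" if "R i j" "R l j" for i j l
    proof -
      from that(1) obtain c where c: "c \<noteq> 0" "x' j = scale c (x i)"
        unfolding R_def by (elim exE conjE)
      from that(2) obtain d where d: "x' j = scale d (x l)"
        unfolding R_def by (elim exE conjE)
      have "x i = scale (inverse c) (scale c (x i))"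
        using c(1) by simp
      also have "\<dots> = scale (inverse c * d) (x l)"
        unfolding c(2)[symmetric] d by simp
      finally show ?thesis by (rule A.generator_eq_scale_generatorD)
    qed
    have 5: "j = l" if "R i j" "R i l" for i j l
    proof -
      from that(1) obtain c where c: "x' j = scale c (x i)"
        unfolding R_def by (elim exE conjE)
      from that(2) obtain d where d: "d \<noteq> 0" "x' l = scale d (x i)"
        unfolding R_def by (elim exE conjE)
      have "x' j = scale (c * inverse d) (x' l)"
        unfolding c d(2) using d(1) by simp
      then show ?thesis by (rule B.generator_eq_scale_generatorD)
    qed
    have "\<exists>\<pi>. bij \<pi> \<and> (\<forall>i. ?f' (\<pi> i) = ?f i) \<and> (\<forall>i. ?f i > 1 \<longrightarrow> R i (\<pi> i))"
      by (rule bij_extending_matching) (fact pos 1 2 3 4 5)+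
    then show thesis
      using that by blast
  qed
  \<comment> \<open>The three ozone elements are instances for functions \<open>h\<close> that
    vanish at 1, so generators of exponent 1, which \<pi> may match arbitrarily, do not occur in
    them.\<close>
  have reindex: "\<exists>c. c \<noteq> 0 \<and> monomial x' (\<lambda>j. h (?f' j)) = scale c (monomial x (\<lambda>i. h (?f i)))"
    if "h 1 = 0" for h :: "nat \<Rightarrow> nat"
  proof (rule monomial_reindex[OF sp sp' \<pi>(1)])
    fix i assume "h (?f i) \<noteq> 0"
    then have "?f i > 1"
      using that pos(1)[of i] by (metis le_neq_implies_less)
    then show "\<exists>c. c \<noteq> 0 \<and> x' (\<pi> i) = scale c (x i)"
      using \<pi>(3) R_def by blast
  qed (simp add: \<pi>(2))
  have "image_mset ?f' (mset_set UNIV) = image_mset ?f' (image_mset \<pi> (mset_set UNIV))"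
    using \<pi>(1) by (simp add: image_mset_mset_set bij_is_inj bij_is_surj)
  also have "\<dots> = image_mset ?f (mset_set UNIV)"
    by (simp add: image_mset.compositionality comp_def \<pi>(2))
  finally show ?thesis
    unfolding ozone_jacobian_def ozone_arrangement_def ozone_discriminant_def
    using reindex[of "\<lambda>m. m - 1"] reindex[of "\<lambda>m. if m > 1 then 1 else 0"]
      reindex[of "\<lambda>m. if m > 1 then m else 0"]
    by simp
qed

end
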